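(* Let $X_1,\ldots,X_n\in\mathfrak{X}$ and $z=(z^1,\ldots,z^n)\in\mathbb{R}^n$. Then $z\in\mathcal{K}_{\mathcal{X}}$ if and only if for every $j=1,\ldots,n$ $$z^j=\inf\left\{\sum_{k=1}^n\theta^kz^k:\ \sum_{k=1}^n\theta^k=1,\ \sum_{k=1}^n\theta^kX_k=X_j,\ \theta\ge0,\ \theta\in\mathbb{R}^n\right\},$$ where $\theta\ge0$ holds componentwise.
   Context: $\mathfrak{X}\subset\mathbb{R}^d$ ($d\ge1$) is a closed convex set with nonempty interior, and $\mathcal{X}=\{X_1,\ldots,X_n\}\subset\mathfrak{X}$. $\mathcal{K}_{\mathcal{X}}$ is the set of all $z=(z^1,\ldots,z^n)\in\mathbb{R}^n$ for which there is a convex function $\psi:\mathfrak{X}\to\mathbb{R}$ with $\psi(X_j)=z^j$ for all $j=1,\ldots,n$. Upper indices denote components of vectors. *)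

theory Defs
  imports "HOL-Analysis.Analysis"
begin

text \<open>The set of vectors of values at the points \<open>X j\<close> of convex functions on the domain \<open>D\<close>.
  It depends on the indexed family \<open>X\<close>, whose points may coincide. A function on \<open>D\<close> is
  represented by a total \<open>\<psi>\<close>; only its values on \<open>D\<close> matter once all \<open>X j\<close> lie in \<open>D\<close>.\<close>

definition convex_data :: "(real ^ 'd) set \<Rightarrow> ('n::finite \<Rightarrow> real ^ 'd) \<Rightarrow> (real ^ 'n) set" where
  "convex_data D X = {z. \<exists>\<psi> :: real ^ 'd \<Rightarrow> real. convex_on D \<psi> \<and> (\<forall>j. \<psi> (X j) = z $ j)}"

end

theory Submission
  imports Defs
begin

text \<open>If \<open>z\<close> comes from a convex function, Jensen's inequality bounds every admissible sum below
  by \<open>z\<^sup>j\<close>, and a unit vector attains the bound. Conversely, the infimum condition says that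
  \<open>(0, -1)\<close> is outside the cone spanned by \<open>(0, 1)\<close> and the vectors
  \<open>(X\<^sub>k - X\<^sub>j, z\<^sup>k - z\<^sup>j)\<close>. This cone is finitely generated, hence closed, and a separating
  hyperplane is the graph of an affine function through \<open>(X\<^sub>j, z\<^sup>j)\<close> lying below all the
  data. The maximum over \<open>j\<close> of these affine functions is convex and interpolates \<open>z\<close>.\<close>

lemma convex_on_Max:
  fixes f :: "'i \<Rightarrow> 'a::real_vector \<Rightarrow> real"
  assumes "finite I" "I \<noteq> {}" "\<And>i. i \<in> I \<Longrightarrow> convex_on D (f i)"
  shows "convex_on D (\<lambda>x. Max ((\<lambda>i. f i x) ` I))"
proof (intro convex_onI)
  show "convex D" using assms by (auto simp: convex_on_def)
next
  fix t :: real and x y assume t: "0 < t" "t < 1" and xy: "x \<in> D" "y \<in> D"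
  let ?M = "\<lambda>x. Max ((\<lambda>i. f i x) ` I)"
  have "f i ((1 - t) *\<^sub>R x + t *\<^sub>R y) \<le> (1 - t) * ?M x + t * ?M y" if "i \<in> I" for i
  proof -
    have "f i ((1 - t) *\<^sub>R x + t *\<^sub>R y) \<le> (1 - t) * f i x + t * f i y"
      using convex_onD[OF assms(3)[OF that]] t xy by simp
    also have "\<dots> \<le> (1 - t) * ?M x + t * ?M y"
      using t assms(1) that by (intro add_mono mult_left_mono) auto
    finally show ?thesis .
  qed
  then show "?M ((1 - t) *\<^sub>R x + t *\<^sub>R y) \<le> (1 - t) * ?M x + t * ?M y"
    using assms(1,2) by simp
qed

text \<open>Because \<open>0\<close> lies in the cone, the offset \<open>b\<close> of a strictly
  separating hyperplane is negative. It can be moved to 0: a point of \<open>C\<close> with negative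
  inner product could be rescaled by the positive factor \<open>b / inner a x\<close> onto level
  \<open>b\<close>, where separation fails.\<close>

lemma closed_convex_cone_separation:
  fixes C :: "'a::euclidean_space set"
  assumes "closed C" "convex_cone C" "p \<notin> C"
  obtains a where "inner a p < 0" "\<And>x. x \<in> C \<Longrightarrow> 0 \<le> inner a x"
proof -
  obtain a b where ab: "inner a p < b" "\<And>x. x \<in> C \<Longrightarrow> b < inner a x"
    using separating_hyperplane_closed_point[of C p] assms unfolding convex_cone_def by blast
  have "b < 0"
    using ab(2)[of 0] convex_cone_contains_0 assms(2) by fastforce
  have "0 \<le> inner a x" if "x \<in> C" for x
  proof (rule ccontr)
    assume neg: "\<not> 0 \<le> inner a x"
    let ?c = "b / inner a x"
    have "?c *\<^sub>R x \<in> C"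
      using neg \<open>b < 0\<close> that assms(2) by (intro convex_cone_scaleR) (auto simp: divide_simps)
    from ab(2)[OF this] neg show False by simp
  qed
  with ab \<open>b < 0\<close> show thesis by (intro that[of a]) auto
qed

text \<open>The vector \<open>u\<close> is a subgradient at \<open>X j\<close> of the largest convex
  function below the data; \<open>min\<close> says that this function does not drop below
  \<open>z $ j\<close> there.\<close>

lemma affine_minorant_exists:
  fixes X :: "'n::finite \<Rightarrow> 'a::euclidean_space" and z :: "real ^ 'n"
  assumes min: "\<And>\<theta> :: real ^ 'n. (\<Sum>k\<in>UNIV. \<theta> $ k) = 1 \<Longrightarrow>
      (\<Sum>k\<in>UNIV. \<theta> $ k *\<^sub>R X k) = X j \<Longrightarrow> (\<And>k. 0 \<le> \<theta> $ k) \<Longrightarrow>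
      z $ j \<le> (\<Sum>k\<in>UNIV. \<theta> $ k * z $ k)"
  shows "\<exists>u. \<forall>k. z $ j + inner u (X k - X j) \<le> z $ k"
proof -
  define S where "S = insert (0, 1) (range (\<lambda>k. (X k - X j, z $ k - z $ j)))"
  \<comment> \<open>\<open>E\<close> describes the cone over \<open>S\<close> by coefficients: the
    multiplier of \<open>(0, 1)\<close> is the slack in the inequality. Membership of
    \<open>(0, -1)\<close> can be tested in \<open>E\<close>, while closedness comes from the hull
    of the finite set \<open>S\<close>; the inclusion of the hull in \<open>E\<close> links the
    two.\<close>
  define E where "E = {p. \<exists>\<mu>. (\<forall>k. 0 \<le> \<mu> k) \<and> fst p = (\<Sum>k\<in>UNIV. \<mu> k *\<^sub>R (X k - X j)) \<and>
    (\<Sum>k\<in>UNIV. \<mu> k * (z $ k - z $ j)) \<le> snd p}"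
  have "convex_cone E"
    unfolding convex_cone_iff
  proof (intro conjI ballI allI impI)
    show "0 \<in> E" unfolding E_def by (auto intro!: exI[of _ "\<lambda>_. 0"])
  next
    fix p q assume "p \<in> E" "q \<in> E"
    then obtain \<mu> \<nu> where "\<forall>k. 0 \<le> \<mu> k" "fst p = (\<Sum>k\<in>UNIV. \<mu> k *\<^sub>R (X k - X j))"
      "(\<Sum>k\<in>UNIV. \<mu> k * (z $ k - z $ j)) \<le> snd p"
      "\<forall>k. 0 \<le> \<nu> k" "fst q = (\<Sum>k\<in>UNIV. \<nu> k *\<^sub>R (X k - X j))"
      "(\<Sum>k\<in>UNIV. \<nu> k * (z $ k - z $ j)) \<le> snd q"
      unfolding E_def by blast
    then show "p + q \<in> E" unfolding E_def
      by (auto intro!: exI[of _ "\<lambda>k. \<mu> k + \<nu> k"]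
          simp: scaleR_add_left distrib_right sum.distrib)
  next
    fix p and c :: real assume "p \<in> E" and c: "0 \<le> c"
    then obtain \<mu> where "\<forall>k. 0 \<le> \<mu> k" "fst p = (\<Sum>k\<in>UNIV. \<mu> k *\<^sub>R (X k - X j))"
      "(\<Sum>k\<in>UNIV. \<mu> k * (z $ k - z $ j)) \<le> snd p"
      unfolding E_def by blast
    with c show "c *\<^sub>R p \<in> E" unfolding E_def
      by (auto intro!: exI[of _ "\<lambda>k. c * \<mu> k"] mult_left_mono
          simp: scaleR_sum_right sum_distrib_left[symmetric] mult.assoc)
  qed
  moreover have "S \<subseteq> E"
  proof -
    have "(0, 1) \<in> E" unfolding E_def by (auto intro!: exI[of _ "\<lambda>_. 0"])
    moreover have "(X i - X j, z $ i - z $ j) \<in> E" for i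
      unfolding E_def
      by (auto intro!: exI[of _ "\<lambda>k. if k = i then 1 else 0"]
          simp: if_distrib[of "\<lambda>c. c *\<^sub>R _"] if_distrib[of "\<lambda>c. c * _"] cong: if_cong)
    ultimately show ?thesis unfolding S_def by blast
  qed
  ultimately have hull_E: "convex_cone hull S \<subseteq> E" by (intro hull_minimal)
  have "(0, -1) \<notin> E"
  proof
    assume "(0, -1) \<in> E"
    then obtain \<mu> where \<mu>: "\<And>k. 0 \<le> \<mu> k" "(\<Sum>k\<in>UNIV. \<mu> k *\<^sub>R (X k - X j)) = 0"
      "(\<Sum>k\<in>UNIV. \<mu> k * (z $ k - z $ j)) \<le> - 1"
      unfolding E_def by auto
    \<comment> \<open>Dividing the coefficients by their total mass \<open>s\<close> gives an
      admissible \<theta> whose value is at most \<open>z $ j - 1 / s\<close>, against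
      \<open>min\<close>.\<close>
    define s where "s = (\<Sum>k\<in>UNIV. \<mu> k)"
    have "s \<noteq> 0"
    proof
      assume "s = 0"
      then have "\<mu> k = 0" for k
        using \<mu>(1) unfolding s_def by (simp add: sum_nonneg_eq_0_iff)
      with \<mu>(3) show False by simp
    qed
    then have s: "s > 0" using sum_nonneg[of UNIV \<mu>] \<mu>(1) unfolding s_def by force
    have X: "(\<Sum>k\<in>UNIV. \<mu> k *\<^sub>R X k) = s *\<^sub>R X j"
      using \<mu>(2) by (simp add: s_def scaleR_diff_right sum_subtractf scaleR_sum_left)
    have Z: "(\<Sum>k\<in>UNIV. \<mu> k * z $ k) \<le> s * z $ j - 1"
      using \<mu>(3) by (simp add: s_def right_diff_distrib sum_subtractf sum_distrib_right)
    define \<theta> :: "real ^ 'n" where "\<theta> = (\<chi> k. \<mu> k / s)"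
    have "z $ j \<le> (\<Sum>k\<in>UNIV. \<theta> $ k * z $ k)"
    proof (rule min)
      show "(\<Sum>k\<in>UNIV. \<theta> $ k) = 1"
        using s by (simp add: \<theta>_def sum_divide_distrib[symmetric] s_def[symmetric])
      have "(\<Sum>k\<in>UNIV. \<theta> $ k *\<^sub>R X k) = (1 / s) *\<^sub>R (\<Sum>k\<in>UNIV. \<mu> k *\<^sub>R X k)"
        by (simp add: \<theta>_def scaleR_sum_right)
      then show "(\<Sum>k\<in>UNIV. \<theta> $ k *\<^sub>R X k) = X j" using X s by simp
      show "0 \<le> \<theta> $ k" for k using \<mu>(1) s by (simp add: \<theta>_def)
    qed
    also have "\<dots> = (\<Sum>k\<in>UNIV. \<mu> k * z $ k) / s"
      by (simp add: \<theta>_def sum_divide_distrib)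
    finally show False using Z s by (simp add: field_simps)
  qed
  with hull_E have "(0, -1) \<notin> convex_cone hull S" by blast
  moreover have "closed (convex_cone hull S)"
    by (intro polyhedron_imp_closed polyhedron_convex_cone_hull) (simp add: S_def)
  ultimately obtain a where a: "inner a (0, -1) < 0" "\<And>x. x \<in> convex_cone hull S \<Longrightarrow> 0 \<le> inner a x"
    using closed_convex_cone_separation convex_cone_convex_cone_hull by metis
  obtain v s where vs: "a = (v, s)" by (cases a)
  \<comment> \<open>The inner product with \<open>(0, -1)\<close> is \<open>- s\<close>, so the
    separating hyperplane is not vertical and can be solved for the last coordinate, with slope
    \<open>- (1 / s) *\<^sub>R v\<close>.\<close>
  with a(1) have s: "s > 0" by simp
  show ?thesis
  proof (intro exI allI)
    fix k
    have "(X k - X j, z $ k - z $ j) \<in> convex_cone hull S"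
      by (rule hull_inc) (auto simp: S_def)
    from a(2)[OF this] have "0 \<le> inner v (X k - X j) + s * (z $ k - z $ j)"
      by (simp add: vs)
    then show "z $ j + inner (- (1 / s) *\<^sub>R v) (X k - X j) \<le> z $ k"
      using s by (simp add: field_simps)
  qed
qed

theorem lemma2p1:
  fixes D :: "(real ^ 'd) set"
    and X :: "'n::finite \<Rightarrow> real ^ 'd"
    and z :: "real ^ 'n"
  assumes "closed D" and "convex D" and "interior D \<noteq> {}"
    and "\<And>j. X j \<in> D"
  shows "z \<in> convex_data D X \<longleftrightarrow>
    (\<forall>j. z $ j = Inf {\<Sum>k\<in>UNIV. \<theta> $ k * z $ k | \<theta> :: real ^ 'n.
      (\<Sum>k\<in>UNIV. \<theta> $ k) = 1 \<and> (\<Sum>k\<in>UNIV. \<theta> $ k *\<^sub>R X k) = X j \<and> (\<forall>k. 0 \<le> \<theta> $ k)})"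
    (is "_ \<longleftrightarrow> (\<forall>j. z $ j = Inf (?A j))")
proof
  assume "z \<in> convex_data D X"
  then obtain \<psi> where \<psi>: "convex_on D \<psi>" "\<And>j. \<psi> (X j) = z $ j"
    unfolding convex_data_def by blast
  show "\<forall>j. z $ j = Inf (?A j)"
  proof
    fix j
    have "Inf (?A j) = z $ j"
    proof (rule cInf_eq_minimum)
      show "z $ j \<in> ?A j"
        by (auto intro!: exI[of _ "axis j 1"]
            simp: axis_def if_distrib[of "\<lambda>c. c *\<^sub>R _"] if_distrib[of "\<lambda>c. c * _"] cong: if_cong)
    next
      fix w assume "w \<in> ?A j"
      then obtain \<theta> :: "real ^ 'n" where \<theta>: "w = (\<Sum>k\<in>UNIV. \<theta> $ k * z $ k)"
        "(\<Sum>k\<in>UNIV. \<theta> $ k) = 1" "(\<Sum>k\<in>UNIV. \<theta> $ k *\<^sub>R X k) = X j" "\<And>k. 0 \<le> \<theta> $ k"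
        by blast
      have "\<psi> (\<Sum>k\<in>UNIV. \<theta> $ k *\<^sub>R X k) \<le> (\<Sum>k\<in>UNIV. \<theta> $ k * \<psi> (X k))"
        using \<theta> assms(4) by (intro convex_on_sum[OF _ _ \<psi>(1)]) auto
      then show "z $ j \<le> w" using \<theta> \<psi>(2) by simp
    qed
    then show "z $ j = Inf (?A j)" by simp
  qed
next
  assume inf: "\<forall>j. z $ j = Inf (?A j)"
  have "\<exists>u. \<forall>k. z $ j + inner u (X k - X j) \<le> z $ k" for j
  proof -
    \<comment> \<open>\<open>Inf\<close> of a real set bounds its elements only if the set is
      bounded below. Here every element is a weighted mean of the entries of \<open>z\<close>, hence
      at least their minimum.\<close>
    have bdd: "bdd_below (?A j)"
    proof (rule bdd_belowI)
      fix w assume "w \<in> ?A j"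
      then obtain \<theta> :: "real ^ 'n" where \<theta>: "w = (\<Sum>k\<in>UNIV. \<theta> $ k * z $ k)"
        "(\<Sum>k\<in>UNIV. \<theta> $ k) = 1" "\<And>k. 0 \<le> \<theta> $ k"
        by blast
      have "Min (range (($) z)) = (\<Sum>k\<in>UNIV. \<theta> $ k * Min (range (($) z)))"
        using \<theta>(2) by (simp add: sum_distrib_right[symmetric])
      also have "\<dots> \<le> w"
        unfolding \<theta>(1) by (intro sum_mono mult_left_mono \<theta>(3)) auto
      finally show "Min (range (($) z)) \<le> w" .
    qed
    have "z $ j \<le> (\<Sum>k\<in>UNIV. \<theta> $ k * z $ k)"
      if "(\<Sum>k\<in>UNIV. \<theta> $ k) = 1" "(\<Sum>k\<in>UNIV. \<theta> $ k *\<^sub>R X k) = X j" "\<And>k. 0 \<le> \<theta> $ k"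
      for \<theta> :: "real ^ 'n"
    proof -
      have "z $ j = Inf (?A j)" using inf by (rule spec)
      also have "\<dots> \<le> (\<Sum>k\<in>UNIV. \<theta> $ k * z $ k)"
        using that by (intro cInf_lower bdd) blast
      finally show ?thesis .
    qed
    then show ?thesis by (rule affine_minorant_exists)
  qed
  then obtain u where u: "\<And>j k. z $ j + inner (u j) (X k - X j) \<le> z $ k" by metis
  define \<psi> where "\<psi> x = Max (range (\<lambda>j. z $ j + inner (u j) (x - X j)))" for x
  have "convex_on D \<psi>"
    unfolding \<psi>_def
    by (intro convex_on_Max convex_onI assms(2)) (auto simp: algebra_simps)
  \<comment> \<open>By \<open>u\<close> no affine piece exceeds \<open>z $ k\<close> at
    \<open>X k\<close>, and the piece with index \<open>k\<close> attains it since its linear term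
    vanishes there.\<close>
  moreover have "\<psi> (X k) = z $ k" for k
    unfolding \<psi>_def using u by (intro Max_eqI) (auto intro!: image_eqI[of _ _ k])
  ultimately show "z \<in> convex_data D X" unfolding convex_data_def by blast
qed

end
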